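(* Let $d_1\ge 2$, and let $w_{11}^*\neq 0$ and $w_{21}^*\neq 0$ be real numbers. Let $\boldsymbol A(t)\in\mathbb R^{2\times d_1}$ and $\boldsymbol B(t)\in\mathbb R^{d_1\times 2}$, $t\ge 0$, with $\boldsymbol a_i(t)\in\mathbb R^{d_1}$ the transpose of the $i$-th row of $\boldsymbol A(t)$ and $\boldsymbol b_j(t)\in\mathbb R^{d_1}$ the $j$-th column of $\boldsymbol B(t)$, evolve by the gradient flow $$\dot{\boldsymbol a}_1=(w_{11}^*-\boldsymbol a_1^\top\boldsymbol b_1)\boldsymbol b_1,\qquad \dot{\boldsymbol a}_2=(w_{21}^*-\boldsymbol a_2^\top\boldsymbol b_1)\boldsymbol b_1,\qquad \dot{\boldsymbol b}_1=(w_{11}^*-\boldsymbol a_1^\top\boldsymbol b_1)\boldsymbol a_1+(w_{21}^*-\boldsymbol a_2^\top\boldsymbol b_1)\boldsymbol a_2 .$$ Assume convergence to a zero-loss solution, i.e. the limits $\boldsymbol a_1(\infty),\boldsymbol a_2(\infty),\boldsymbol b_1(\infty)$ as $t\to\infty$ exist and $\boldsymbol a_1(\infty)^\top\boldsymbol b_1(\infty)=w_{11}^*$, $\boldsymbol a_2(\infty)^\top\boldsymbol b_1(\infty)=w_{21}^*$. Put $\boldsymbol u^*=\boldsymbol b_1(\infty)/\|\boldsymbol b_1(\infty)\|_2$ and $\boldsymbol a_{i\perp}(\infty)=\boldsymbol a_i(\infty)-(\boldsymbol a_i(\infty)^\top\boldsymbol u^* )\boldsymbol u^*$. Then for $i=1,2$,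 $$\frac{\|\boldsymbol a_{i\perp}(\infty)\|_2^2}{\|\boldsymbol a_i(\infty)\|_2^2}\le\frac{\|\boldsymbol A(0)\|_F^2\left(\sqrt{\|\boldsymbol b_1(0)\|_2^4+4{w_{11}^*}^2+4{w_{21}^*}^2}+\|\boldsymbol b_1(0)\|_2^2\right)}{2{w_{i1}^*}^2}.$$
   Context: The flow is the gradient flow of $\tfrac12\sum_{i=1}^2\big((\boldsymbol A\boldsymbol B)_{i1}-w_{i1}^*\big)^2$ in the entries of $\boldsymbol A,\boldsymbol B$ (matrix completion of a $2\times2$ matrix whose first column is observed; the column $\boldsymbol b_2$ stays constant). $\|\cdot\|_F$ is the Frobenius norm. *)

theory Defs
  imports "HOL-Analysis.Analysis"
begin

definition frobenius_norm :: "real ^ 'n ^ 'm \<Rightarrow> real" where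
  "frobenius_norm M = sqrt (\<Sum>i\<in>UNIV. \<Sum>j\<in>UNIV. (M $ i $ j)\<^sup>2)"

lemma frobenius_norm_eq_norm: "frobenius_norm M = norm M"
  by (simp add: frobenius_norm_def norm_vec_def L2_set_def sum_nonneg)

end

theory Submission
  imports Defs
begin

text \<open>
  The flow conserves the symmetric matrix
  \<open>a\<^sub>1 a\<^sub>1\<^sup>T + a\<^sub>2 a\<^sub>2\<^sup>T - b\<^sub>1 b\<^sub>1\<^sup>T\<close>. Evaluated in the direction of \<open>u = u\<^sup>*\<close>, where
  \<open>a\<^sub>i(\<infinity>) \<bullet> u = w\<^sub>i / |b\<^sub>1(\<infinity>)|\<close>, conservation shows that \<open>x = |b\<^sub>1(\<infinity>)|\<^sup>2\<close> satisfies
  \<open>x\<^sup>2 \<le> |b\<^sub>1(0)|\<^sup>2 x + w\<^sub>1\<^sup>2 + w\<^sub>2\<^sup>2\<close>, so \<open>x\<close> is at most the positive root of this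
  quadratic. On the orthogonal complement of \<open>u\<close>, taking the trace, it shows that
  the squared norms of the \<open>a\<^sub>i\<^sub>\<perp>(\<infinity>)\<close> sum up to at most \<open>|A(0)|\<^sup>2\<close>. Finally
  \<open>|a\<^sub>i(\<infinity>)|\<^sup>2 \<ge> w\<^sub>i\<^sup>2 / x\<close>.
\<close>

text \<open>The quantity is kept for any coefficients \<open>r1\<close>, \<open>r2\<close>: by
  symmetry of \<open>h\<close>, the terms \<open>2 * r1 t * h (a1 t) (b t)\<close> and
  \<open>2 * r2 t * h (a2 t) (b t)\<close> from the first two squares are exactly the derivative of
  \<open>h (b t) (b t)\<close>. Leaving \<open>h\<close> general lets one proof serve both the trace
  and a single direction.\<close>

lemma flow_conserved:
  fixes a1 a2 b :: "real \<Rightarrow> 'a::real_normed_vector" and r1 r2 :: "real \<Rightarrow> real"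
    and h :: "'a \<Rightarrow> 'a \<Rightarrow> real"
  assumes h: "bounded_bilinear h" and sym: "\<And>x y. h x y = h y x"
    and a1: "\<And>t. t \<ge> 0 \<Longrightarrow> (a1 has_vector_derivative r1 t *\<^sub>R b t) (at t within {0..})"
    and a2: "\<And>t. t \<ge> 0 \<Longrightarrow> (a2 has_vector_derivative r2 t *\<^sub>R b t) (at t within {0..})"
    and b: "\<And>t. t \<ge> 0 \<Longrightarrow>
      (b has_vector_derivative r1 t *\<^sub>R a1 t + r2 t *\<^sub>R a2 t) (at t within {0..})"
    and lim: "(a1 \<longlongrightarrow> p) at_top" "(a2 \<longlongrightarrow> q) at_top" "(b \<longlongrightarrow> s) at_top"
  shows "h p p + h q q - h s s = h (a1 0) (a1 0) + h (a2 0) (a2 0) - h (b 0) (b 0)"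
proof -
  interpret h: bounded_bilinear h by (rule h)
  define Q where "Q t = h (a1 t) (a1 t) + h (a2 t) (a2 t) - h (b t) (b t)" for t
  have "(Q has_vector_derivative 0) (at t within {0..})" if "t \<in> {0..}" for t
  proof -
    from that have "t \<ge> 0" by simp
    note D = a1[OF this] a2[OF this] b[OF this]
    have "(Q has_vector_derivative
        (h (a1 t) (r1 t *\<^sub>R b t) + h (r1 t *\<^sub>R b t) (a1 t))
      + (h (a2 t) (r2 t *\<^sub>R b t) + h (r2 t *\<^sub>R b t) (a2 t))
      - (h (b t) (r1 t *\<^sub>R a1 t + r2 t *\<^sub>R a2 t) + h (r1 t *\<^sub>R a1 t + r2 t *\<^sub>R a2 t) (b t)))
      (at t within {0..})"
      unfolding Q_def
      by (intro has_vector_derivative_add has_vector_derivative_diff h.has_vector_derivative D)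
    then show ?thesis
      by (simp add: h.add_left h.add_right h.scaleR_left h.scaleR_right sym[of "b t"] algebra_simps)
  qed
  then obtain c where c: "\<And>t. t \<in> {0..} \<Longrightarrow> Q t = c"
    using has_vector_derivative_zero_constant[of "{0..}" Q] by auto
  have "(Q \<longlongrightarrow> h p p + h q q - h s s) at_top"
    unfolding Q_def by (intro tendsto_intros h.tendsto lim)
  moreover have "(Q \<longlongrightarrow> c) at_top"
    by (rule tendsto_eventually) (use c in \<open>auto intro: eventually_at_top_linorderI[of 0]\<close>)
  ultimately have "h p p + h q q - h s s = c"
    by (rule tendsto_unique[OF trivial_limit_at_top_linorder])
  then show ?thesis
    using c[of 0] by (simp add: Q_def)
qed

text \<open>Completing the square turns the assumption into
  \<open>(2 * x - c)\<^sup>2 \<le> c\<^sup>2 + 4 * w\<close>.\<close>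

lemma le_positive_root:
  fixes x c w :: real
  assumes "x\<^sup>2 \<le> c * x + w"
  shows "x \<le> (sqrt (c\<^sup>2 + 4 * w) + c) / 2"
proof -
  have "2 * x - c \<le> sqrt (c\<^sup>2 + 4 * w)"
    by (rule real_le_rsqrt) (use assms in \<open>simp add: power2_eq_square algebra_simps\<close>)
  then show ?thesis by simp
qed

lemma norm_diff_proj_sq:
  fixes a u :: "'a::real_inner"
  assumes "norm u = 1"
  shows "(norm (a - (a \<bullet> u) *\<^sub>R u))\<^sup>2 = (norm a)\<^sup>2 - (a \<bullet> u)\<^sup>2"
proof -
  have "u \<bullet> u = 1" using assms by (simp add: dot_square_norm)
  then show ?thesis
    unfolding power2_norm_eq_inner
    by (simp add: inner_diff_left inner_diff_right inner_commute power2_eq_square)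
qed

lemma inner_unit_sq_le:
  fixes a u :: "'a::real_inner"
  assumes "norm u = 1"
  shows "(a \<bullet> u)\<^sup>2 \<le> (norm a)\<^sup>2"
  using norm_diff_proj_sq[OF assms, of a] zero_le_power2[of "norm (a - (a \<bullet> u) *\<^sub>R u)"] by linarith

lemma frobenius_norm_sq_rows:
  fixes M :: "real ^ 'n ^ 2"
  shows "(frobenius_norm M)\<^sup>2 = (norm (row 1 M))\<^sup>2 + (norm (row 2 M))\<^sup>2"
  by (simp add: frobenius_norm_eq_norm power2_norm_eq_inner inner_vec_def[of M M] sum_2 row_def)

theorem theorem3p1:
  fixes A :: "real \<Rightarrow> real ^ 'd ^ 2"
    and B :: "real \<Rightarrow> real ^ 2 ^ 'd"
    and w11 w21 :: real
    and a1_inf a2_inf b1_inf :: "real ^ 'd"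
  defines "a1 \<equiv> \<lambda>t. row 1 (A t)"
    and "a2 \<equiv> \<lambda>t. row 2 (A t)"
    and "b1 \<equiv> \<lambda>t. column 1 (B t)"
    and "b2 \<equiv> \<lambda>t. column 2 (B t)"
  assumes dim: "CARD('d) \<ge> 2"
    and w11_nonzero: "w11 \<noteq> 0"
    and w21_nonzero: "w21 \<noteq> 0"
    and flow_a1: "\<And>t. t \<ge> 0 \<Longrightarrow>
      (a1 has_vector_derivative (w11 - a1 t \<bullet> b1 t) *\<^sub>R b1 t) (at t within {0..})"
    and flow_a2: "\<And>t. t \<ge> 0 \<Longrightarrow>
      (a2 has_vector_derivative (w21 - a2 t \<bullet> b1 t) *\<^sub>R b1 t) (at t within {0..})"
    and flow_b1: "\<And>t. t \<ge> 0 \<Longrightarrow>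
      (b1 has_vector_derivative
        (w11 - a1 t \<bullet> b1 t) *\<^sub>R a1 t + (w21 - a2 t \<bullet> b1 t) *\<^sub>R a2 t) (at t within {0..})"
    and flow_b2: "\<And>t. t \<ge> 0 \<Longrightarrow> b2 t = b2 0"
    and lim_a1: "(a1 \<longlongrightarrow> a1_inf) at_top"
    and lim_a2: "(a2 \<longlongrightarrow> a2_inf) at_top"
    and lim_b1: "(b1 \<longlongrightarrow> b1_inf) at_top"
    and zero_loss1: "a1_inf \<bullet> b1_inf = w11"
    and zero_loss2: "a2_inf \<bullet> b1_inf = w21"
  defines "u \<equiv> b1_inf /\<^sub>R norm b1_inf"
  defines "a1_perp \<equiv> a1_inf - (a1_inf \<bullet> u) *\<^sub>R u"
    and "a2_perp \<equiv> a2_inf - (a2_inf \<bullet> u) *\<^sub>R u"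
  shows "(norm a1_perp)\<^sup>2 / (norm a1_inf)\<^sup>2
      \<le> (frobenius_norm (A 0))\<^sup>2
          * (sqrt (norm (b1 0) ^ 4 + 4 * w11\<^sup>2 + 4 * w21\<^sup>2) + (norm (b1 0))\<^sup>2)
          / (2 * w11\<^sup>2)
    \<and> (norm a2_perp)\<^sup>2 / (norm a2_inf)\<^sup>2
      \<le> (frobenius_norm (A 0))\<^sup>2
          * (sqrt (norm (b1 0) ^ 4 + 4 * w11\<^sup>2 + 4 * w21\<^sup>2) + (norm (b1 0))\<^sup>2)
          / (2 * w21\<^sup>2)"
proof -
  define x where "x = (norm b1_inf)\<^sup>2"
  define F where "F = (norm (a1 0))\<^sup>2 + (norm (a2 0))\<^sup>2"
  have F: "(frobenius_norm (A 0))\<^sup>2 = F"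
    by (simp add: frobenius_norm_sq_rows F_def a1_def a2_def)
  have F0: "F \<ge> 0" by (simp add: F_def)
  have b_nz: "b1_inf \<noteq> 0" using zero_loss1 w11_nonzero by auto
  then have x0: "x > 0" by (simp add: x_def)
  have u: "norm u = 1" using b_nz by (simp add: u_def)
  have au: "(a \<bullet> u)\<^sup>2 = (a \<bullet> b1_inf)\<^sup>2 / x" for a
    by (simp add: u_def x_def power_mult_distrib power_inverse divide_inverse mult.commute)
  have bu: "(b1_inf \<bullet> u)\<^sup>2 = x"
    using x0 unfolding au by (simp add: dot_square_norm power2_eq_square[of x] flip: x_def)

  note cons = flow_conserved[OF _ _ flow_a1 flow_a2 flow_b1 lim_a1 lim_a2 lim_b1]
  have trace: "(norm a1_inf)\<^sup>2 + (norm a2_inf)\<^sup>2 - x = F - (norm (b1 0))\<^sup>2"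
    using cons[OF bounded_bilinear_inner inner_commute]
    by (simp add: F_def x_def power2_norm_eq_inner)
  \<comment> \<open>This rank-one form evaluates the conserved matrix in the direction
    \<open>u\<close>, just as the inner product gave its trace.\<close>
  have "bounded_bilinear (\<lambda>v w :: real ^ 'd. (v \<bullet> u) * (w \<bullet> u))"
    by (rule bounded_bilinear.comp[OF bounded_bilinear_mult]) (rule bounded_linear_inner_left)+
  from cons[OF this mult.commute]
  have dir: "(a1_inf \<bullet> u)\<^sup>2 + (a2_inf \<bullet> u)\<^sup>2 - x
      = (a1 0 \<bullet> u)\<^sup>2 + (a2 0 \<bullet> u)\<^sup>2 - (b1 0 \<bullet> u)\<^sup>2"
    by (simp add: bu[symmetric] power2_eq_square)

  have b0u: "(b1 0 \<bullet> u)\<^sup>2 \<le> (norm (b1 0))\<^sup>2" by (rule inner_unit_sq_le[OF u])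
  \<comment> \<open>Subtracting \<open>dir\<close> from \<open>trace\<close> cancels
    \<open>x\<close>. What remains on the right is \<open>F\<close> minus two squares and minus the
    nonnegative gap in \<open>b0u\<close>.\<close>
  have perp: "(norm a1_perp)\<^sup>2 + (norm a2_perp)\<^sup>2 \<le> F"
    using trace dir b0u zero_le_power2[of "a1 0 \<bullet> u"] zero_le_power2[of "a2 0 \<bullet> u"]
    unfolding a1_perp_def a2_perp_def norm_diff_proj_sq[OF u] by linarith

  \<comment> \<open>Here \<open>dir\<close> is used alone: the initial squares of the
    \<open>a\<close>'s are dropped, and zero loss fixes the final ones through
    \<open>au\<close>.\<close>
  have "x \<le> (w11\<^sup>2 + w21\<^sup>2) / x + (norm (b1 0))\<^sup>2"
    using dir b0u zero_le_power2[of "a1 0 \<bullet> u"] zero_le_power2[of "a2 0 \<bullet> u"]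
    unfolding au[of a1_inf] au[of a2_inf] zero_loss1 zero_loss2 add_divide_distrib by linarith
  then have "x\<^sup>2 \<le> (norm (b1 0))\<^sup>2 * x + (w11\<^sup>2 + w21\<^sup>2)"
    using x0 by (simp add: field_simps power2_eq_square)
  from le_positive_root[OF this]
  have root: "2 * x \<le> sqrt (norm (b1 0) ^ 4 + 4 * w11\<^sup>2 + 4 * w21\<^sup>2) + (norm (b1 0))\<^sup>2"
    by (simp add: algebra_simps flip: power_mult)

  \<comment> \<open>Stated for a generic pair so that it covers both rows: each perpendicular part
    is bounded by the sum in \<open>perp\<close>, hence by \<open>F\<close>.\<close>
  have bound: "(norm p)\<^sup>2 / (norm a)\<^sup>2 \<le> (frobenius_norm (A 0))\<^sup>2
      * (sqrt (norm (b1 0) ^ 4 + 4 * w11\<^sup>2 + 4 * w21\<^sup>2) + (norm (b1 0))\<^sup>2) / (2 * w\<^sup>2)"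
    if p: "(norm p)\<^sup>2 \<le> F" and a: "a \<bullet> b1_inf = w" and w: "w \<noteq> 0" for p a :: "real ^ 'd" and w
  proof -
    have "w\<^sup>2 / x \<le> (norm a)\<^sup>2"
      using inner_unit_sq_le[OF u, of a] by (simp add: au a)
    then have "(norm p)\<^sup>2 / (norm a)\<^sup>2 \<le> F / (w\<^sup>2 / x)"
      using p w x0 F0 by (intro frac_le) auto
    also have "\<dots> = F * (2 * x) / (2 * w\<^sup>2)" by simp
    also have "\<dots> \<le> F * (sqrt (norm (b1 0) ^ 4 + 4 * w11\<^sup>2 + 4 * w21\<^sup>2) + (norm (b1 0))\<^sup>2) / (2 * w\<^sup>2)"
      using root F0 by (intro divide_right_mono mult_left_mono) auto
    finally show ?thesis by (simp add: F)
  qed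
  show ?thesis
    using perp zero_le_power2[of "norm a1_perp"] zero_le_power2[of "norm a2_perp"]
    by (intro conjI bound zero_loss1 zero_loss2 w11_nonzero w21_nonzero) linarith+
qed

end
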